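(* Fix $p\in(0,1)$. Then, as $n\to\infty$, \[ \max_{\sigma\in S_n}\mathcal{E}_{S_n}(\sigma) \le \Big(\frac{1+\sqrt{1-p}}{p}\Big) n + o_p(n), \] where the $o_p(n)$ term depends only on $p$ and $n$.
   Context: $S_n$ is the lattice of permutations of $[n]$ under the right weak order (generated by $\sigma\circ(i\ i{+}1)\lessdot\sigma$ whenever $\sigma(i)>\sigma(i+1)$). For $p\in(0,1]$, the Ungarian Markov chain on $S_n$ moves from $\sigma$ by selecting each descent $i$ of $\sigma$ (an index with $\sigma(i)>\sigma(i+1)$) independently with probability $p$ and moving to the meet of $\sigma$ and all $\sigma\circ(i\ i{+}1)$ for selected $i$; equivalently, all selected descents are reversed, with maximal runs of consecutive selected indices reversed as blocks. $\mathcal{E}_{S_n}(\sigma)$ denotes the expected number of steps for this chain started at $\sigma$ to reach the identity permutation. *)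

theory Defs
  imports "HOL-Probability.Probability" "HOL-Combinatorics.Multiset_Permutations"
    "HOL-Library.Landau_Symbols"
begin

text \<open>Permutations of [n] = {0..<n} are represented as lists (one-line notation),
  positions are 0-indexed.\<close>

definition perms :: "nat \<Rightarrow> nat list set" where
  "perms n = permutations_of_set {0..<n}"

definition descents :: "nat list \<Rightarrow> nat set" where
  "descents \<sigma> = {i. Suc i < length \<sigma> \<and> \<sigma> ! i > \<sigma> ! Suc i}"

text \<open>Reverse maximal blocks of positions joined by selected indices: position i and i+1
  are in the same block iff i \<in> D. The accumulator holds the current block reversed.\<close>
fun rev_blocks :: "nat set \<Rightarrow> nat \<Rightarrow> nat list \<Rightarrow> nat list \<Rightarrow> nat list" where
  "rev_blocks D i cur [] = cur"
| "rev_blocks D i cur (x # xs) =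
     (if i \<in> D then rev_blocks D (Suc i) (x # cur) xs
      else (x # cur) @ rev_blocks D (Suc i) [] xs)"

definition ungar_step :: "real \<Rightarrow> nat list \<Rightarrow> nat list pmf" where
  "ungar_step p \<sigma> =
     map_pmf (\<lambda>f. rev_blocks {i \<in> descents \<sigma>. f i} 0 [] \<sigma>)
       (Pi_pmf (descents \<sigma>) False (\<lambda>_. bernoulli_pmf p))"

definition ungar_dist :: "real \<Rightarrow> nat list \<Rightarrow> nat \<Rightarrow> nat list pmf" where
  "ungar_dist p \<sigma> t = ((\<lambda>M. bind_pmf M (ungar_step p)) ^^ t) (return_pmf \<sigma>)"

text \<open>Expected hitting time of the identity. The identity is absorbing (it has no
  descents), so the hitting time T satisfies T > t iff X_t is not the identity, and
  E[T] = sum over t of P(T > t).\<close>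
definition ungar_E :: "real \<Rightarrow> nat list \<Rightarrow> ennreal" where
  "ungar_E p \<sigma> =
     (\<Sum>t. ennreal (measure_pmf.prob (ungar_dist p \<sigma> t) {\<tau>. \<tau> \<noteq> [0..<length \<sigma>]}))"

end

theory Submission
  imports Defs "HOL-Real_Asymp.Real_Asymp"
begin

text \<open>
  Fix a threshold \<open>k\<close> and regard the entries \<open>\<ge> k\<close> as particles and the others as holes. A selected
  descent from a particle to a hole moves that particle to the right by at least one step, and no
  other selection hurts, so the particles dominate a parallel-update TASEP in which an unblocked
  particle jumps with probability \<open>p\<close>. The dominated TASEP may moreover be slowed down: its
  front particle jumps only with probability \<open>\<alpha> < p\<close>, and it is started from extra independent gaps
  that make it stationary. The gap behind a particle is then a discrete-time queue, and Burke's
  theorem for this queue shows inductively that every particle, in particular the last one,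
  performs a Bernoulli(\<open>\<alpha>\<close>) walk. Hence the word is sorted as soon as this walk exceeds \<open>k\<close> plus
  the sum of the \<open>n - k - 1\<close> initial gaps. For \<open>\<alpha> = 1 - sqrt (1 - p)\<close> the gaps have
  mean 1, so that about \<open>n / \<alpha> = (1 + sqrt (1 - p)) / p * n\<close> steps suffice for every \<open>k\<close>; a Chernoff
  bound makes the failure probability small enough to be summed over all thresholds and times.
\<close>

section \<open>Block reversals and thresholds\<close>

lemma length_filter_drop_le:
  "length (filter P (drop v xs)) \<le> min (length (filter P xs)) (length xs - v)"
proof -
  have "length (filter P xs) = length (filter P (take v xs)) + length (filter P (drop v xs))"
    by (metis append_take_drop_id filter_append length_append)
  then show ?thesis
    using length_filter_le[of P "drop v xs"] by simp
qed

lemma length_filter_drop_sorted: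
  fixes k :: "'a::linorder"
  assumes "sorted s"
  shows "length (filter (\<lambda>x. k \<le> x) (drop v s)) =
    min (length (filter (\<lambda>x. k \<le> x) s)) (length s - v)"
  using assms
proof (induction s arbitrary: v)
  case (Cons x s)
  show ?case
  proof (cases v)
    case 0
    then show ?thesis
      using length_filter_le[of "\<lambda>x. k \<le> x" "x # s"] by (simp del: filter.simps)
  next
    case (Suc w)
    have IH: "length (filter (\<lambda>x. k \<le> x) (drop w s)) =
        min (length (filter (\<lambda>x. k \<le> x) s)) (length s - w)"
      using Cons by simp
    show ?thesis
    proof (cases "k \<le> x")
      case True
      with Cons.prems have "filter (\<lambda>x. k \<le> x) s = s"
        by (auto simp: filter_id_conv)
      with Suc IH True show ?thesis by simp
    next
      case False
      with Suc IH show ?thesis by simp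
    qed
  qed
qed simp

text \<open>A selected block is a decreasing list \<open>rev s\<close> and becomes \<open>s\<close>.
  The increasing order attains the bound of \<open>length_filter_drop_le\<close> for every suffix at
  once.\<close>

lemma length_filter_drop_rev_sorted:
  fixes k :: "'a::linorder"
  assumes "sorted s"
  shows "length (filter (\<lambda>x. k \<le> x) (drop v (rev s))) \<le> length (filter (\<lambda>x. k \<le> x) (drop v s))"
  using length_filter_drop_le[of "\<lambda>x. k \<le> x" v "rev s"] length_filter_drop_sorted[OF assms, of k v]
  by (simp add: rev_filter[symmetric])

text \<open>Behind a descent of \<open>rev s\<close> from large to small no large entry is left,
  whereas every nonempty suffix of \<open>s\<close> contains one as soon as \<open>s\<close>
  does.\<close>

lemma length_filter_drop_rev_sorted_strict:
  fixes k :: "'a::linorder"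
  assumes s: "sorted s" and m: "Suc m < length s" and big: "k \<le> rev s ! m" and small: "rev s ! Suc m < k"
  shows "length (filter (\<lambda>x. k \<le> x) (drop (Suc m) (rev s)))
    < length (filter (\<lambda>x. k \<le> x) (drop (Suc m) s))"
proof -
  have "x < k" if "x \<in> set (drop (Suc m) (rev s))" for x
  proof -
    from that obtain j where j: "j < length s - Suc m" "x = rev s ! (Suc m + j)"
      using m by (auto simp: in_set_conv_nth)
    have "rev s ! (Suc m + j) \<le> rev s ! Suc m"
      using s j(1) by (auto simp: rev_nth intro!: sorted_nth_mono)
    with j small show ?thesis by simp
  qed
  then have "filter (\<lambda>x. k \<le> x) (drop (Suc m) (rev s)) = []"
    by (auto simp: filter_empty_conv not_le)
  moreover have "rev s ! m \<in> set s"
    using m by (metis Suc_lessD length_rev nth_mem set_rev)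
  then have "filter (\<lambda>x. k \<le> x) s \<noteq> []"
    using big by (auto simp: filter_empty_conv)
  ultimately show ?thesis
    using m by (simp add: length_filter_drop_sorted[OF s])
qed

section \<open>Suffix counts under block reversals\<close>

lemma mset_rev_blocks: "mset (rev_blocks D i cur xs) = mset cur + mset xs"
  by (induction D i cur xs rule: rev_blocks.induct) auto

text \<open>As a function of \<open>v\<close> this is the height function of the particle
  configuration for threshold \<open>k\<close>.\<close>

definition cnt :: "nat \<Rightarrow> nat \<Rightarrow> nat list \<Rightarrow> nat" where
  "cnt k v \<sigma> = length (filter (\<lambda>x. k \<le> x) (drop v \<sigma>))"

lemma cnt_append: "cnt k v (xs @ ys) = cnt k v xs + cnt k (v - length xs) ys"
  by (simp add: cnt_def)

text \<open>In the recursion of \<^const>\<open>rev_blocks\<close>, \<open>rev cur\<close> is the part of the current block read so far.\<close>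

lemma cnt_rev_blocks_ge:
  assumes "sorted cur"
    and "\<And>j. i + j \<in> D \<Longrightarrow> Suc j < length xs \<Longrightarrow> xs ! Suc j \<le> xs ! j"
    and "cur \<noteq> [] \<Longrightarrow> xs \<noteq> [] \<Longrightarrow> hd xs \<le> hd cur"
  shows "cnt k v (rev cur @ xs) \<le> cnt k v (rev_blocks D i cur xs)"
  using assms
proof (induction xs arbitrary: i cur v)
  case Nil
  then show ?case
    using length_filter_drop_rev_sorted[of cur k v] by (simp add: cnt_def)
next
  case (Cons x xs)
  have s: "sorted (x # cur)"
    using Cons.prems by (cases cur) auto
  have D: "xs ! Suc j \<le> xs ! j" if "Suc i + j \<in> D" "Suc j < length xs" for j
    using Cons.prems(2)[of "Suc j"] that by simp
  show ?case
  proof (cases "i \<in> D")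
    case True
    have "hd xs \<le> x" if "xs \<noteq> []"
      using Cons.prems(2)[of 0] True that by (cases xs) auto
    then show ?thesis
      using Cons.IH[of "x # cur" "Suc i" v, OF s D] True by simp
  next
    case False
    have "cnt k w xs \<le> cnt k w (rev_blocks D (Suc i) [] xs)" for w
      using Cons.IH[of "[]" "Suc i" w] D by simp
    moreover have "cnt k v (rev (x # cur)) \<le> cnt k v (x # cur)"
      using length_filter_drop_rev_sorted[OF s, of k v] by (simp add: cnt_def)
    ultimately have "cnt k v (rev (x # cur) @ xs) \<le> cnt k v ((x # cur) @ rev_blocks D (Suc i) [] xs)"
      unfolding cnt_append by (simp add: add_mono)
    then show ?thesis using False by simp
  qed
qed

text \<open>The last hypothesis puts positions \<open>m\<close> and \<open>Suc m\<close>, counted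
  from the start of the current block, into one block. That block gains strictly; the others are
  covered by \<open>cnt_rev_blocks_ge\<close>.\<close>

lemma cnt_rev_blocks_gt:
  assumes "sorted cur"
    and "\<And>j. i + j \<in> D \<Longrightarrow> Suc j < length xs \<Longrightarrow> xs ! Suc j \<le> xs ! j"
    and "cur \<noteq> [] \<Longrightarrow> xs \<noteq> [] \<Longrightarrow> hd xs \<le> hd cur"
    and "Suc m < length (rev cur @ xs)" "k \<le> (rev cur @ xs) ! m" "(rev cur @ xs) ! Suc m < k"
    and "m < length cur \<or> i + (m - length cur) \<in> D"
  shows "cnt k (Suc m) (rev cur @ xs) < cnt k (Suc m) (rev_blocks D i cur xs)"
  using assms
proof (induction xs arbitrary: i cur m)
  case Nil
  then show ?case
    using length_filter_drop_rev_sorted_strict[of cur m k] by (simp add: cnt_def)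
next
  case (Cons x xs)
  have s: "sorted (x # cur)"
    using Cons.prems by (cases cur) auto
  have D: "xs ! Suc j \<le> xs ! j" if "Suc i + j \<in> D" "Suc j < length xs" for j
    using Cons.prems(2)[of "Suc j"] that by simp
  show ?case
  proof (cases "i \<in> D")
    case True
    have hd: "hd xs \<le> hd (x # cur)" if "xs \<noteq> []"
      using Cons.prems(2)[of 0] True that by (cases xs) auto
    have "m < length (x # cur) \<or> Suc i + (m - length (x # cur)) \<in> D"
      using Cons.prems(7) by (cases "m \<le> length cur") (auto simp: Suc_diff_Suc not_le)
    then have "cnt k (Suc m) (rev (x # cur) @ xs) < cnt k (Suc m) (rev_blocks D (Suc i) (x # cur) xs)"
      using Cons.prems(4-6) by (intro Cons.IH[OF s D hd]) auto
    then show ?thesis using True by simp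
  next
    case False
    have ge: "cnt k w xs \<le> cnt k w (rev_blocks D (Suc i) [] xs)" for w
      using cnt_rev_blocks_ge[of "[]" "Suc i" D xs k w] D by simp
    have "cnt k (Suc m) (rev (x # cur) @ xs)
        < cnt k (Suc m) ((x # cur) @ rev_blocks D (Suc i) [] xs)"
    proof (cases "m < length cur")
      case True
      have "rev (x # cur) ! m = (rev cur @ x # xs) ! m"
        "rev (x # cur) ! Suc m = (rev cur @ x # xs) ! Suc m"
        using True by (auto simp: nth_append)
      then have "cnt k (Suc m) (rev (x # cur)) < cnt k (Suc m) (x # cur)"
        using length_filter_drop_rev_sorted_strict[OF s, of m k] True Cons.prems(5,6)
        unfolding cnt_def by simp
      then show ?thesis
        using ge[of "Suc m - length (x # cur)"] unfolding cnt_append by simp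
    next
      case m: False
      \<comment> \<open>\<open>m = length cur\<close> would be the junction after \<open>x\<close>,
        whose index \<open>i\<close> is not selected. So the descent lies in a later block.\<close>
      with Cons.prems(7) False have "m \<noteq> length cur" by auto
      with m obtain w where w: "m = Suc (length cur + w)"
        by (metis add_Suc_right less_imp_Suc_add nat_neq_iff)
      have "cnt k (Suc w) xs < cnt k (Suc w) (rev_blocks D (Suc i) [] xs)"
        using Cons.IH[of "[]" "Suc i" w] D Cons.prems(4-7) w by (simp add: nth_append)
      moreover have "cnt k (Suc m) (rev (x # cur)) \<le> cnt k (Suc m) (x # cur)"
        using length_filter_drop_rev_sorted[OF s, of k "Suc m"] by (simp add: cnt_def)
      ultimately show ?thesis
        using w unfolding cnt_append by simp
    qed
    then show ?thesis using False by simp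
  qed
qed

text \<open>The positions of the particles for threshold \<open>k\<close>, listed from right to left.\<close>

definition bigs :: "nat \<Rightarrow> nat list \<Rightarrow> nat list" where
  "bigs k \<sigma> = rev (filter (\<lambda>j. k \<le> \<sigma> ! j) [0..<length \<sigma>])"

lemma set_bigs: "set (bigs k \<sigma>) = {j. j < length \<sigma> \<and> k \<le> \<sigma> ! j}"
  by (auto simp: bigs_def)

lemma bigs_decreasing: "sorted_wrt (>) (bigs k \<sigma>)"
  by (simp add: bigs_def sorted_wrt_rev sorted_wrt_filter)

lemma distinct_bigs: "distinct (bigs k \<sigma>)"
  by (simp add: bigs_def)

lemma bigs_nth_less: "i < j \<Longrightarrow> j < length (bigs k \<sigma>) \<Longrightarrow> bigs k \<sigma> ! j < bigs k \<sigma> ! i"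
  using bigs_decreasing by (auto simp: sorted_wrt_iff_nth_less)

lemma cnt_eq: "cnt k v \<sigma> = length (filter (\<lambda>j. v \<le> j) (bigs k \<sigma>))"
proof -
  have "filter (\<lambda>j. v \<le> j) [0..<n] = [v..<n]" for n
    by (induction n) auto
  then have "drop v \<sigma> = map ((!) \<sigma>) (filter (\<lambda>j. v \<le> j) [0..<length \<sigma>])"
    by (metis drop_map drop_upt map_nth add_0)
  then show ?thesis
    by (simp add: cnt_def bigs_def filter_map o_def rev_filter[symmetric] conj_commute)
qed

lemma cnt_0: "cnt k 0 \<sigma> = length (bigs k \<sigma>)"
  by (simp add: cnt_eq)

text \<open>In a decreasing list the entries that are at least \<open>v\<close> form an initial
  segment.\<close>

lemma decreasing_nth_ge_iff:
  fixes v :: nat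
  shows "sorted_wrt (>) xs \<Longrightarrow> i < length xs \<Longrightarrow> v \<le> xs ! i \<longleftrightarrow> i < length (filter (\<lambda>j. v \<le> j) xs)"
proof (induction xs arbitrary: i)
  case (Cons x xs)
  show ?case
  proof (cases "v \<le> x")
    case True
    with Cons show ?thesis by (cases i) auto
  next
    case False
    with Cons.prems have "filter (\<lambda>j. v \<le> j) xs = []" "(x # xs) ! i < v"
      by (auto simp: filter_empty_conv nth_Cons split: nat.splits) (meson nth_mem less_trans not_le)+
    with False show ?thesis by simp
  qed
qed simp

text \<open>The dictionary between suffix counts and particle positions, through which the
  configurations before and after a step are compared.\<close>

lemma bigs_nth_ge_iff: "i < length (bigs k \<sigma>) \<Longrightarrow> v \<le> bigs k \<sigma> ! i \<longleftrightarrow> i < cnt k v \<sigma>"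
  unfolding cnt_eq by (rule decreasing_nth_ge_iff[OF bigs_decreasing])

text \<open>The particles behind particle \<open>i\<close> need distinct positions to its
  left.\<close>

lemma bigs_nth_lower: "i < length (bigs k \<sigma>) \<Longrightarrow> length (bigs k \<sigma>) \<le> Suc i + bigs k \<sigma> ! i"
proof -
  assume i: "i < length (bigs k \<sigma>)"
  let ?v = "length (bigs k \<sigma>) - Suc i"
  have "length (bigs k \<sigma>) \<le> cnt k ?v \<sigma> + ?v"
  proof -
    have "length (bigs k \<sigma>) = length (filter (\<lambda>x. k \<le> x) (take ?v \<sigma> @ drop ?v \<sigma>))"
      using cnt_0[of k \<sigma>] by (simp add: cnt_def)
    also have "\<dots> = length (filter (\<lambda>x. k \<le> x) (take ?v \<sigma>)) + cnt k ?v \<sigma>"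
      unfolding cnt_def filter_append by simp
    finally show ?thesis
      using length_filter_le[of "\<lambda>x. k \<le> x" "take ?v \<sigma>"] by simp
  qed
  then show ?thesis
    using bigs_nth_ge_iff[OF i, of ?v] i by linarith
qed

lemma length_bigs_rev_blocks: "length (bigs k (rev_blocks D 0 [] \<sigma>)) = length (bigs k \<sigma>)"
proof -
  have "length (filter (\<lambda>x. k \<le> x) \<sigma>') = size (filter_mset (\<lambda>x. k \<le> x) (mset \<sigma>'))" for \<sigma>'
    by (metis mset_filter size_mset)
  then show ?thesis
    by (simp add: cnt_0[symmetric] cnt_def mset_rev_blocks)
qed

lemma bigs_rev_blocks_ge:
  assumes D: "D \<subseteq> descents \<sigma>" and i: "i < length (bigs k \<sigma>)"
  shows "bigs k \<sigma> ! i \<le> bigs k (rev_blocks D 0 [] \<sigma>) ! i"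
proof -
  have "i < cnt k (bigs k \<sigma> ! i) \<sigma>"
    using bigs_nth_ge_iff[OF i] by blast
  also have "\<dots> \<le> cnt k (bigs k \<sigma> ! i) (rev_blocks D 0 [] \<sigma>)"
    using cnt_rev_blocks_ge[of "[]" 0 D \<sigma> k "bigs k \<sigma> ! i"] D by (force simp: descents_def)
  finally show ?thesis
    using i by (simp add: bigs_nth_ge_iff length_bigs_rev_blocks)
qed

text \<open>A particle on the next site would have an index \<open>j < i\<close>, and then particle
  \<open>i - 1\<close> could not be beyond that site.\<close>

lemma bigs_unblocked:
  assumes i: "i < length (bigs k \<sigma>)" and "Suc (bigs k \<sigma> ! i) < length \<sigma>"
    and "0 < i \<Longrightarrow> Suc (bigs k \<sigma> ! i) < bigs k \<sigma> ! (i - 1)"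
  shows "\<sigma> ! Suc (bigs k \<sigma> ! i) < k"
proof (rule ccontr)
  assume "\<not> ?thesis"
  then have "Suc (bigs k \<sigma> ! i) \<in> set (bigs k \<sigma>)"
    using assms(2) by (simp add: set_bigs)
  then obtain j where j: "j < length (bigs k \<sigma>)" "bigs k \<sigma> ! j = Suc (bigs k \<sigma> ! i)"
    by (auto simp: in_set_conv_nth)
  have "j < i"
    using j i bigs_nth_less[of i j k \<sigma>] by (cases i j rule: linorder_cases) auto
  then have "bigs k \<sigma> ! (i - 1) \<le> bigs k \<sigma> ! j"
    using bigs_nth_less[of j "i - 1" k \<sigma>] i by (cases "j = i - 1") (auto intro: less_imp_le)
  with j assms(3) \<open>j < i\<close> show False by simp
qed

text \<open>The \<open>i\<close> particles in front already lie at \<open>Suc ?x\<close> or beyond;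
  the strict gain in the count there forces particle \<open>i\<close> to join them.\<close>

lemma bigs_rev_blocks_gt:
  assumes D: "D \<subseteq> descents \<sigma>" and i: "i < length (bigs k \<sigma>)"
    and sel: "bigs k \<sigma> ! i \<in> D" and small: "\<sigma> ! Suc (bigs k \<sigma> ! i) < k"
  shows "bigs k \<sigma> ! i < bigs k (rev_blocks D 0 [] \<sigma>) ! i"
proof -
  let ?x = "bigs k \<sigma> ! i"
  have big: "k \<le> \<sigma> ! ?x"
    using nth_mem[OF i] by (simp add: set_bigs)
  have "i \<le> cnt k (Suc ?x) \<sigma>"
  proof (cases i)
    case (Suc j)
    then show ?thesis
      using bigs_nth_less[of j i k \<sigma>] bigs_nth_ge_iff[of j k \<sigma> "Suc ?x"] i by simp
  qed simp
  also have "\<dots> < cnt k (Suc ?x) (rev_blocks D 0 [] \<sigma>)"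
    using cnt_rev_blocks_gt[of "[]" 0 D \<sigma> ?x k] D sel small big by (force simp: descents_def)
  finally show ?thesis
    using i bigs_nth_ge_iff[of i k "rev_blocks D 0 [] \<sigma>" "Suc ?x"] by (simp add: length_bigs_rev_blocks)
qed

section \<open>Sortedness of a permutation read off from all thresholds\<close>

lemma perms_mset_iff: "\<sigma> \<in> perms n \<longleftrightarrow> mset \<sigma> = mset [0..<n]"
proof -
  have "\<sigma> \<in> perms n \<longleftrightarrow> distinct \<sigma> \<and> set \<sigma> = set [0..<n]"
    by (auto simp: perms_def permutations_of_set_def)
  also have "\<dots> \<longleftrightarrow> mset \<sigma> = mset [0..<n]"
    by (metis distinct_upt mset_eq_imp_distinct_iff set_eq_iff_mset_eq_distinct)
  finally show ?thesis .
qed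

lemma length_perms: "\<sigma> \<in> perms n \<Longrightarrow> length \<sigma> = n"
  by (metis perms_mset_iff mset_eq_length length_upt diff_zero)

lemma rev_blocks_perms: "\<sigma> \<in> perms n \<Longrightarrow> rev_blocks D 0 [] \<sigma> \<in> perms n"
  by (simp add: perms_mset_iff mset_rev_blocks)

lemma length_bigs_perms:
  assumes "\<sigma> \<in> perms n"
  shows "length (bigs k \<sigma>) = n - k"
proof -
  have "length (bigs k \<sigma>) = length (filter (\<lambda>x. k \<le> x) \<sigma>)"
    using cnt_0[of k \<sigma>] by (simp add: cnt_def)
  also have "\<dots> = length (filter (\<lambda>x. k \<le> x) [0..<n])"
    using assms by (metis perms_mset_iff mset_filter size_mset)
  also have "filter (\<lambda>x. k \<le> x) [0..<n] = [k..<n]"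
    by (induction n) auto
  finally show ?thesis by simp
qed

text \<open>If the last particle for threshold \<open>k\<close> is at \<open>k\<close> or beyond,
  all entries from position \<open>k\<close> on are at least \<open>k\<close>. If this held for
  every \<open>k\<close>, each entry would be at least its position, and equal sums would force the
  identity.\<close>

lemma perms_not_id_bigs:
  assumes \<sigma>: "\<sigma> \<in> perms n" and "\<sigma> \<noteq> [0..<n]"
  shows "\<exists>k\<in>{0<..<n}. bigs k \<sigma> ! (n - k - 1) < k"
proof (rule ccontr)
  assume none: "\<not> ?thesis"
  have ge: "k \<le> \<sigma> ! k" if "k < n" for k
  proof (cases "k = 0")
    case False
    have "\<not> bigs k \<sigma> ! (n - k - 1) < k"
      using none that False by auto
    then have "n - k - 1 < cnt k k \<sigma>"
      using bigs_nth_ge_iff[of "n - k - 1" k \<sigma> k] length_bigs_perms[OF \<sigma>, of k] \<open>k < n\<close> by auto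
    then have "length (drop k \<sigma>) \<le> length (filter (\<lambda>x. k \<le> x) (drop k \<sigma>))"
      using length_perms[OF \<sigma>] by (simp add: cnt_def)
    then have "filter (\<lambda>x. k \<le> x) (drop k \<sigma>) = drop k \<sigma>"
      by (metis filter_id_conv length_filter_less not_le)
    then have "\<forall>x\<in>set (drop k \<sigma>). k \<le> x"
      by (simp add: filter_id_conv)
    moreover have "\<sigma> ! k \<in> set (drop k \<sigma>)"
      using \<open>k < n\<close> length_perms[OF \<sigma>] by (metis Cons_nth_drop_Suc list.set_intros(1))
    ultimately show ?thesis by blast
  qed simp
  have "sum_list \<sigma> = sum_list [0..<n]"
    using \<sigma> by (metis perms_mset_iff sum_mset_sum_list)
  then have "(\<Sum>k<n. \<sigma> ! k) = (\<Sum>k<n. k)"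
    using length_perms[OF \<sigma>] by (simp add: sum_list_sum_nth atLeast0LessThan)
  then have "\<sigma> ! k = k" if "k < n" for k
    using sum_mono_inv[of "\<lambda>k. k" "{..<n}" "\<lambda>k. \<sigma> ! k" k] ge that by auto
  with assms(2) length_perms[OF \<sigma>] show False
    by (auto intro: nth_equalityI)
qed

section \<open>Stationary TASEP\<close>

text \<open>A zero-modified geometric law: the stationary length of a discrete-time queue with
  arrival probability \<open>1 - s\<close> and service probability \<open>1 - s^2\<close>. Its mean
  is 1 for every positive \<open>s\<close>.\<close>

definition gap_pmf :: "real \<Rightarrow> nat pmf" where
  "gap_pmf s = do {b \<leftarrow> bernoulli_pmf (1 / (1 + s));
     if b then map_pmf Suc (geometric_pmf (1 / (1 + s))) else return_pmf 0}"

lemma pmf_gap_0: "0 < s \<Longrightarrow> pmf (gap_pmf s) 0 = s / (1 + s)"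
  by (simp add: gap_pmf_def pmf_bind pmf_map_outside field_simps)

lemma pmf_gap_Suc:
  assumes "0 < s"
  shows "pmf (gap_pmf s) (Suc h) = (s / (1 + s)) ^ h / (1 + s)\<^sup>2"
proof -
  have "1 - 1 / (1 + s) = s / (1 + s)"
    using assms by (simp add: field_simps)
  moreover have "pmf (map_pmf Suc (geometric_pmf (1 / (1 + s)))) (Suc h) = pmf (geometric_pmf (1 / (1 + s))) h"
    by (rule pmf_map_inj') simp
  ultimately show ?thesis
    using assms by (simp add: gap_pmf_def pmf_bind power2_eq_square)
qed

text \<open>Here \<open>d\<close> and \<open>b \<and> 0 < g\<close> are the jumps of two neighbouring particles with
  gap \<open>g\<close>, the front one first.\<close>

lemma queue_burke:
  assumes s: "0 < s" "s < 1"
  shows "do {d \<leftarrow> bernoulli_pmf (1 - s); g \<leftarrow> gap_pmf s; b \<leftarrow> bernoulli_pmf (1 - s\<^sup>2);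
      return_pmf (g + of_bool d - of_bool (b \<and> 0 < g), b \<and> 0 < g)}
    = pair_pmf (gap_pmf s) (bernoulli_pmf (1 - s))"
    (is "?L = ?R")
proof (rule pmf_eqI)
  fix he :: "nat \<times> bool"
  obtain h e where he: "he = (h, e)" by force
  have s2: "0 \<le> 1 - s\<^sup>2" "1 - s\<^sup>2 \<le> 1"
    using s by (auto simp: power_le_one)
  define F where "F g = do {d \<leftarrow> bernoulli_pmf (1 - s); b \<leftarrow> bernoulli_pmf (1 - s\<^sup>2);
      return_pmf (g + of_bool d - of_bool (b \<and> 0 < g), b \<and> 0 < g)}" for g :: nat
  have F: "pmf (F g) (h, e) =
     (if e then (if 0 < g then (1 - s\<^sup>2) * ((1 - s) * of_bool (g = h) + s * of_bool (g = Suc h)) else 0)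
      else (if 0 < g then s\<^sup>2 else 1) * ((1 - s) * of_bool (Suc g = h) + s * of_bool (g = h)))" for g h e
    using s s2 by (auto simp: F_def pmf_bind indicator_def algebra_simps of_bool_def)
  have "pmf ?L he = pmf (bind_pmf (gap_pmf s) F) (h, e)"
    unfolding F_def he by (subst bind_commute_pmf) simp
  also have "\<dots> = (LINT g|gap_pmf s. pmf (F g) (h, e))"
    by (simp add: pmf_bind)
  \<comment> \<open>The gap changes by at most one, so only these old gaps can lead to
    \<open>h\<close>.\<close>
  also have "\<dots> = (\<Sum>g\<in>{h - 1, h, Suc h}. pmf (gap_pmf s) g *\<^sub>R pmf (F g) (h, e))"
    by (rule integral_measure_pmf) (auto simp: F of_bool_def split: if_splits)
  \<comment> \<open>The law has a separate value at 0 and the sum reaches down to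
    \<open>h - 1\<close>, so 0, 1 and larger \<open>h\<close> are computed separately.\<close>
  also have "\<dots> = pmf ?R he"
  proof (cases h)
    case 0
    then show ?thesis
      using s by (cases e) (auto simp: F he pmf_pair pmf_gap_0 pmf_gap_Suc divide_simps power2_eq_square, auto simp: algebra_simps)
  next
    case (Suc h')
    show ?thesis
    proof (cases h')
      case 0
      then show ?thesis using Suc
        using s by (cases e) (auto simp: F he pmf_pair pmf_gap_0 pmf_gap_Suc divide_simps power2_eq_square, auto simp: algebra_simps)
    next
      case (Suc h'')
      with \<open>h = Suc h'\<close> show ?thesis
        using s by (cases e) (auto simp: F he pmf_pair pmf_gap_0 pmf_gap_Suc divide_simps power2_eq_square, auto simp: algebra_simps)
    qed
  qed
  finally show "pmf ?L he = pmf ?R he" .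
qed

text \<open>\<open>d\<close> is the jump of the particle in front of the first gap, and the coin \<open>hd bs\<close> belongs to the
  particle behind it.\<close>

fun gaps_step :: "bool \<Rightarrow> nat list \<Rightarrow> bool list \<Rightarrow> nat list" where
  "gaps_step d [] bs = []"
| "gaps_step d (g # gs) bs =
     (g + of_bool d - of_bool (hd bs \<and> 0 < g)) # gaps_step (hd bs \<and> 0 < g) gs (tl bs)"

fun last_jump :: "bool \<Rightarrow> nat list \<Rightarrow> bool list \<Rightarrow> bool" where
  "last_jump d [] bs = d"
| "last_jump d (g # gs) bs = last_jump (hd bs \<and> 0 < g) gs (tl bs)"

text \<open>By \<open>queue_burke\<close> the departure from the first queue is independent of its
  new length and again Bernoulli, so it can serve as the arrival for the remaining \<open>m\<close>
  queues.\<close>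

lemma gaps_burke:
  assumes s: "0 < s" "s < 1"
  shows "do {d \<leftarrow> bernoulli_pmf (1 - s); gs \<leftarrow> replicate_pmf m (gap_pmf s);
      bs \<leftarrow> replicate_pmf m (bernoulli_pmf (1 - s\<^sup>2));
      return_pmf (gaps_step d gs bs, last_jump d gs bs)}
    = pair_pmf (replicate_pmf m (gap_pmf s)) (bernoulli_pmf (1 - s))"
proof (induction m)
  case 0
  show ?case
    by (simp add: bind_return_pmf pair_pmf_def)
next
  case (Suc m)
  let ?B = "bernoulli_pmf (1 - s)" and ?C = "bernoulli_pmf (1 - s\<^sup>2)" and ?G = "gap_pmf s"
  let ?GG = "replicate_pmf m ?G" and ?CC = "replicate_pmf m ?C"
  have "do {d \<leftarrow> ?B; gs \<leftarrow> replicate_pmf (Suc m) ?G; bs \<leftarrow> replicate_pmf (Suc m) ?C;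
      return_pmf (gaps_step d gs bs, last_jump d gs bs)}
    = do {d \<leftarrow> ?B; g \<leftarrow> ?G; gs \<leftarrow> ?GG; b \<leftarrow> ?C; bs \<leftarrow> ?CC;
      return_pmf ((g + of_bool d - of_bool (b \<and> 0 < g)) # gaps_step (b \<and> 0 < g) gs bs,
        last_jump (b \<and> 0 < g) gs bs)}"
    by (simp add: bind_assoc_pmf bind_return_pmf)
  \<comment> \<open>The coin of the first queue is drawn before the other gaps, so that
    \<open>queue_burke\<close> applies to the first three draws.\<close>
  also have "\<dots> = do {d \<leftarrow> ?B; g \<leftarrow> ?G; b \<leftarrow> ?C; gs \<leftarrow> ?GG; bs \<leftarrow> ?CC;
      return_pmf ((g + of_bool d - of_bool (b \<and> 0 < g)) # gaps_step (b \<and> 0 < g) gs bs,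
        last_jump (b \<and> 0 < g) gs bs)}"
    by (subst (2) bind_commute_pmf) (rule refl)
  also have "\<dots> = do {(h, e) \<leftarrow> do {d \<leftarrow> ?B; g \<leftarrow> ?G; b \<leftarrow> ?C;
        return_pmf (g + of_bool d - of_bool (b \<and> 0 < g), b \<and> 0 < g)};
      gs \<leftarrow> ?GG; bs \<leftarrow> ?CC; return_pmf (h # gaps_step e gs bs, last_jump e gs bs)}"
    by (simp add: bind_assoc_pmf bind_return_pmf)
  also have "\<dots> = do {h \<leftarrow> ?G; (hs, e) \<leftarrow> do {e \<leftarrow> ?B; gs \<leftarrow> ?GG; bs \<leftarrow> ?CC;
      return_pmf (gaps_step e gs bs, last_jump e gs bs)}; return_pmf (h # hs, e)}"
    unfolding queue_burke[OF s] by (simp add: bind_assoc_pmf bind_return_pmf pair_pmf_def)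
  also have "\<dots> = pair_pmf (replicate_pmf (Suc m) ?G) ?B"
    unfolding Suc.IH by (simp add: bind_assoc_pmf bind_return_pmf pair_pmf_def)
  finally show ?case .
qed

text \<open>The state consists of the gaps from front to back and the displacement of the last particle.\<close>

definition tasep_step :: "real \<Rightarrow> nat list \<times> nat \<Rightarrow> (nat list \<times> nat) pmf" where
  "tasep_step s = (\<lambda>(gs, N). do {d \<leftarrow> bernoulli_pmf (1 - s);
     bs \<leftarrow> replicate_pmf (length gs) (bernoulli_pmf (1 - s\<^sup>2));
     return_pmf (gaps_step d gs bs, N + of_bool (last_jump d gs bs))})"

definition tasep_dist :: "real \<Rightarrow> nat list \<Rightarrow> nat \<Rightarrow> (nat list \<times> nat) pmf" where
  "tasep_dist s gs t = ((\<lambda>M. bind_pmf M (tasep_step s)) ^^ t) (return_pmf (gs, 0))"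

text \<open>Independence of the current gaps from the accumulated displacement is the induction
  invariant: \<open>gaps_burke\<close> restores it and adds one independent Bernoulli jump.\<close>

lemma tasep_dist_stationary:
  assumes s: "0 < s" "s < 1"
  shows "bind_pmf (replicate_pmf m (gap_pmf s)) (\<lambda>gs. tasep_dist s gs t) =
    pair_pmf (replicate_pmf m (gap_pmf s)) (binomial_pmf t (1 - s))"
proof (induction t)
  case 0
  have "binomial_pmf 0 (1 - s) = return_pmf 0"
    using s by (intro binomial_pmf_0) auto
  then show ?case
    by (simp add: tasep_dist_def pair_pmf_def bind_return_pmf)
next
  case (Suc t)
  let ?B = "bernoulli_pmf (1 - s)" and ?C = "bernoulli_pmf (1 - s\<^sup>2)" and ?G = "gap_pmf s"
  let ?GG = "replicate_pmf m ?G" and ?CC = "replicate_pmf m ?C" and ?N = "binomial_pmf t (1 - s)"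
  have len: "length gs = m" if "gs \<in> set_pmf ?GG" for gs
    using that by (simp add: set_replicate_pmf)
  have "bind_pmf ?GG (\<lambda>gs. tasep_dist s gs (Suc t)) =
      bind_pmf (bind_pmf ?GG (\<lambda>gs. tasep_dist s gs t)) (tasep_step s)"
    by (simp add: tasep_dist_def bind_assoc_pmf)
  also have "\<dots> = bind_pmf (pair_pmf ?GG ?N) (tasep_step s)"
    unfolding Suc.IH ..
  also have "\<dots> = do {N \<leftarrow> ?N; gs \<leftarrow> ?GG; tasep_step s (gs, N)}"
    unfolding pair_pmf_def bind_assoc_pmf bind_return_pmf by (rule bind_commute_pmf)
  also have "\<dots> = do {N \<leftarrow> ?N; gs \<leftarrow> ?GG; d \<leftarrow> ?B; bs \<leftarrow> ?CC;
      return_pmf (gaps_step d gs bs, N + of_bool (last_jump d gs bs))}"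
    by (intro bind_pmf_cong refl) (simp add: tasep_step_def len)
  also have "\<dots> = do {N \<leftarrow> ?N; d \<leftarrow> ?B; gs \<leftarrow> ?GG; bs \<leftarrow> ?CC;
      return_pmf (gaps_step d gs bs, N + of_bool (last_jump d gs bs))}"
    by (subst (2) bind_commute_pmf) (rule refl)
  also have "\<dots> = do {N \<leftarrow> ?N; (hs, e) \<leftarrow> do {d \<leftarrow> ?B; gs \<leftarrow> ?GG; bs \<leftarrow> ?CC;
      return_pmf (gaps_step d gs bs, last_jump d gs bs)}; return_pmf (hs, N + of_bool e)}"
    by (simp add: bind_assoc_pmf bind_return_pmf)
  also have "\<dots> = do {N \<leftarrow> ?N; hs \<leftarrow> ?GG; e \<leftarrow> ?B; return_pmf (hs, N + of_bool e)}"
    unfolding gaps_burke[OF s] by (simp add: bind_assoc_pmf bind_return_pmf pair_pmf_def)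
  also have "\<dots> = do {hs \<leftarrow> ?GG; N \<leftarrow> ?N; e \<leftarrow> ?B; return_pmf (hs, N + of_bool e)}"
    by (rule bind_commute_pmf)
  also have "\<dots> = do {hs \<leftarrow> ?GG; e \<leftarrow> ?B; N \<leftarrow> ?N; return_pmf (hs, N + of_bool e)}"
    by (subst (2) bind_commute_pmf) (rule refl)
  also have "\<dots> = pair_pmf ?GG (binomial_pmf (Suc t) (1 - s))"
    using s by (simp add: binomial_pmf_Suc pair_pmf_def bind_assoc_pmf bind_return_pmf of_bool_def add.commute)
  finally show ?case .
qed

section \<open>Coupling\<close>

text \<open>For reading the coins attached to positions along the list of particles: distinct
  positions carry independent coins.\<close>

lemma map_Pi_pmf_replicate:
  assumes "finite A" "distinct xs" "set xs \<subseteq> A"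
  shows "map_pmf (\<lambda>f. map f xs) (Pi_pmf A dflt (\<lambda>_. q)) = replicate_pmf (length xs) q"
  using assms
proof (induction xs arbitrary: A)
  case (Cons x xs)
  let ?A = "A - {x}"
  have "Pi_pmf A dflt (\<lambda>_. q) = Pi_pmf (insert x ?A) dflt (\<lambda>_. q)"
    using Cons.prems by (simp add: insert_absorb)
  also have "\<dots> = do {y \<leftarrow> q; f \<leftarrow> Pi_pmf ?A dflt (\<lambda>_. q); return_pmf (f(x := y))}"
    using Cons.prems by (intro Pi_pmf_insert') auto
  finally have "map_pmf (\<lambda>f. map f (x # xs)) (Pi_pmf A dflt (\<lambda>_. q)) =
      do {y \<leftarrow> q; f \<leftarrow> Pi_pmf ?A dflt (\<lambda>_. q); return_pmf (y # map (f(x := y)) xs)}"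
    by (simp add: map_bind_pmf)
  also have "\<dots> = do {y \<leftarrow> q; l \<leftarrow> map_pmf (\<lambda>f. map f xs) (Pi_pmf ?A dflt (\<lambda>_. q)); return_pmf (y # l)}"
    unfolding bind_map_pmf using Cons.prems
    by (intro bind_pmf_cong refl) (auto intro!: arg_cong[of _ _ return_pmf] map_cong)
  also have "map_pmf (\<lambda>f. map f xs) (Pi_pmf ?A dflt (\<lambda>_. q)) = replicate_pmf (length xs) q"
    by (intro Cons.IH) (use Cons.prems in auto)
  finally show ?case by simp
qed (simp add: map_pmf_const)

text \<open>Since \<open>(1 - s^2) / (1 + s) = 1 - s\<close>, an extra coin slows the front particle
  down to the stationary rate.\<close>

lemma bernoulli_pmf_thin:
  assumes "0 < s" "s < 1"
  shows "do {b \<leftarrow> bernoulli_pmf (1 - s\<^sup>2); c \<leftarrow> bernoulli_pmf (1 / (1 + s)); return_pmf (b \<and> c)}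
    = bernoulli_pmf (1 - s)"
proof (rule pmf_eqI)
  fix e
  define c where "c = 1 / (1 + s)"
  have c: "0 \<le> c" "c \<le> 1" and cs: "(1 - s\<^sup>2) * c = 1 - s"
    using assms by (auto simp: c_def field_simps power2_eq_square)
  have "0 \<le> 1 - s\<^sup>2" "1 - s\<^sup>2 \<le> 1"
    using assms by (auto simp: power_le_one)
  then show "pmf (do {b \<leftarrow> bernoulli_pmf (1 - s\<^sup>2); c \<leftarrow> bernoulli_pmf (1 / (1 + s)); return_pmf (b \<and> c)}) e
    = pmf (bernoulli_pmf (1 - s)) e"
    using assms c cs unfolding c_def[symmetric] by (cases e) (simp_all add: pmf_bind indicator_def algebra_simps)
qed

section \<open>TASEP positions and the coupling invariant\<close>

lemma length_gaps_step [simp]: "length (gaps_step d gs bs) = length gs"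
  by (induction d gs bs rule: gaps_step.induct) auto

text \<open>The sum counts the holes between particle \<open>i\<close> and the last particle. Jumps
  strictly in between cancel; only those of the two end particles remain.\<close>

lemma sum_drop_gaps_step:
  assumes "i \<le> length gs" "length bs = length gs"
  shows "int (sum_list (drop i (gaps_step d gs bs))) + of_bool (last_jump d gs bs) =
    int (sum_list (drop i gs)) + of_bool (if i = 0 then d else bs ! (i - 1) \<and> 0 < gs ! (i - 1))"
  using assms
proof (induction gs arbitrary: i d bs)
  case (Cons g gs)
  then obtain b bs' where bs: "bs = b # bs'" "length bs' = length gs"
    by (cases bs) auto
  show ?case
  proof (cases i)
    case 0
    then show ?thesis
      using Cons.IH[of 0 bs' "b \<and> 0 < g"] bs by (auto simp: of_bool_def)
  next
    case (Suc j)
    then show ?thesis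
      using Cons.IH[of j bs' "b \<and> 0 < g"] bs Cons.prems by (cases j) auto
  qed
qed auto

text \<open>Positions are rebuilt from the position \<open>l\<close> of the last particle. They are
  integers because the initial gaps push that particle to the left of 0.\<close>

definition tasep_pos :: "int \<Rightarrow> nat list \<Rightarrow> nat \<Rightarrow> int" where
  "tasep_pos l gs i = l + int (length gs - i) + int (sum_list (drop i gs))"

text \<open>The \<open>i\<close>-th particle of \<open>\<sigma>\<close> cannot move beyond position \<open>n - 1 - i\<close>, whereas the TASEP lives on
  the whole line; \<open>l\<close> is the initial position of its last particle.\<close>

definition coupled :: "nat \<Rightarrow> nat \<Rightarrow> int \<Rightarrow> nat list \<Rightarrow> nat list \<times> nat \<Rightarrow> bool" where
  "coupled n k l \<sigma> = (\<lambda>(gs, N). \<sigma> \<in> perms n \<and> length gs = n - k - 1 \<and>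
     (\<forall>i<n - k. min (tasep_pos (l + int N) gs i) (int n - 1 - int i) \<le> int (bigs k \<sigma> ! i)))"

text \<open>Both systems read the same coins \<open>f\<close>, and \<open>c\<close> thins the front
  one. Where domination is tight, room in front of the TASEP particle gives room in front of the
  true one, whose coin then selects a genuine descent.\<close>

lemma coupled_step:
  fixes f :: "nat \<Rightarrow> bool" and c :: bool
  assumes R: "coupled n k l \<sigma> (gs, N)" and k: "k < n"
  defines "D \<equiv> {i \<in> descents \<sigma>. f i}" and "bs \<equiv> map f (tl (bigs k \<sigma>))"
    and "d \<equiv> f (hd (bigs k \<sigma>)) \<and> c"
  shows "coupled n k l (rev_blocks D 0 [] \<sigma>) (gaps_step d gs bs, N + of_bool (last_jump d gs bs))"
proof -
  let ?x = "bigs k \<sigma>" and ?x' = "bigs k (rev_blocks D 0 [] \<sigma>)"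
  let ?P = "tasep_pos (l + int N) gs"
  have \<sigma>: "\<sigma> \<in> perms n" and gs: "length gs = n - k - 1"
    and dom: "\<And>i. i < n - k \<Longrightarrow> min (?P i) (int n - 1 - int i) \<le> int (?x ! i)"
    using R by (auto simp: coupled_def)
  have len: "length ?x = n - k"
    using \<sigma> by (rule length_bigs_perms)
  have D: "D \<subseteq> descents \<sigma>" by (auto simp: D_def)
  define J where "J i \<longleftrightarrow> (if i = 0 then d else bs ! (i - 1) \<and> 0 < gs ! (i - 1))" for i
  have pos': "tasep_pos (l + int (N + of_bool (last_jump d gs bs))) (gaps_step d gs bs) i = ?P i + of_bool (J i)"
    if "i < n - k" for i
  proof -
    have "length bs = length gs"
      using len gs by (simp add: bs_def)
    then have "int (sum_list (drop i (gaps_step d gs bs))) + of_bool (last_jump d gs bs) =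
        int (sum_list (drop i gs)) + of_bool (J i)"
      unfolding J_def using that gs by (intro sum_drop_gaps_step) auto
    then show ?thesis
      unfolding tasep_pos_def of_nat_add of_nat_of_bool length_gaps_step by linarith
  qed
  have "min (?P i + of_bool (J i)) (int n - 1 - int i) \<le> int (?x' ! i)" if i: "i < n - k" for i
  proof -
    have mono: "?x ! i \<le> ?x' ! i"
      using bigs_rev_blocks_ge[OF D] i len by simp
    \<comment> \<open>The true particle has to move only if the bound is tight and the TASEP jump
      would break it.\<close>
    show ?thesis
    proof (cases "J i \<and> \<not> min (?P i + 1) (int n - 1 - int i) \<le> int (?x ! i)")
      case False
      then show ?thesis using dom[OF i] mono by (auto simp: of_bool_def)
    next
      case True
      then have eq: "int (?x ! i) = ?P i" and lt: "int (?x ! i) < int n - 1 - int i" and Ji: "J i"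
        using dom[OF i] by auto
      have "?x \<noteq> []"
        using i len by auto
      then have f: "f (?x ! i)"
        using Ji i len by (auto simp: J_def d_def bs_def nth_tl hd_conv_nth split: if_splits)
      \<comment> \<open>A positive gap puts TASEP particle \<open>j\<close> at least two sites
        ahead. Its cap is one more than that of particle \<open>i\<close>, hence also at least two
        sites ahead by \<open>lt\<close>.\<close>
      have free: "Suc (?x ! i) < ?x ! (i - 1)" if "0 < i"
      proof -
        obtain j where j: "i = Suc j" using \<open>0 < i\<close> by (cases i) auto
        have "0 < gs ! j" using Ji j by (simp add: J_def)
        moreover have "drop j gs = gs ! j # drop i gs"
          using j i gs by (simp add: Cons_nth_drop_Suc)
        ultimately have "?P j \<ge> ?P i + 2"
          using j i gs by (simp add: tasep_pos_def)
        then show ?thesis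
          using dom[of j] j i eq lt by simp
      qed
      have Suc: "Suc (?x ! i) < length \<sigma>"
        using lt length_perms[OF \<sigma>] by simp
      have small: "\<sigma> ! Suc (?x ! i) < k"
        using bigs_unblocked[of i k \<sigma>] Suc free i len by simp
      moreover have "k \<le> \<sigma> ! (?x ! i)"
        using nth_mem[of i ?x] i len by (simp add: set_bigs)
      ultimately have "?x ! i \<in> D"
        using f Suc by (simp add: D_def descents_def)
      then have "?x ! i < ?x' ! i"
        using bigs_rev_blocks_gt[OF D _ _ small] i len by simp
      then show ?thesis
        using eq Ji by simp
    qed
  qed
  with pos' show ?thesis
    using rev_blocks_perms[OF \<sigma>] gs by (simp add: coupled_def)
qed

text \<open>Both one-step laws are written as images of the same coins \<open>(f, c)\<close>, which
  reduces the claim to \<open>coupled_step\<close>.\<close>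

lemma rel_ungar_tasep_step:
  assumes s: "0 < s" "s < 1" and R: "coupled n k l \<sigma> y" and k: "k < n"
  shows "rel_pmf (coupled n k l) (ungar_step (1 - s\<^sup>2) \<sigma>) (tasep_step s y)"
proof -
  obtain gs N where y: "y = (gs, N)" by force
  let ?q = "bernoulli_pmf (1 - s\<^sup>2)" and ?c = "bernoulli_pmf (1 / (1 + s))"
  let ?x = "bigs k \<sigma>" and ?F = "Pi_pmf {..<n} False (\<lambda>_. bernoulli_pmf (1 - s\<^sup>2))"
  define G where "G d bs = (gaps_step d gs bs, N + of_bool (last_jump d gs bs))" for d bs
  have \<sigma>: "\<sigma> \<in> perms n" and gs: "length gs = n - k - 1"
    using R by (auto simp: coupled_def y)
  have len: "length ?x = Suc (length gs)"
    using length_bigs_perms[OF \<sigma>] gs k by simp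
  \<comment> \<open>Coins are drawn at all positions because the TASEP reads those of all particles,
    including particles that are not at a descent.\<close>
  have "descents \<sigma> \<subseteq> {..<n}"
    using length_perms[OF \<sigma>] by (auto simp: descents_def)
  then have "ungar_step (1 - s\<^sup>2) \<sigma> = map_pmf (\<lambda>f. rev_blocks {i \<in> descents \<sigma>. f i} 0 [] \<sigma>) ?F"
    unfolding ungar_step_def
    by (subst Pi_pmf_subset[of "{..<n}"]) (auto simp: map_pmf_comp intro!: map_pmf_cong arg_cong[of _ _ "\<lambda>D. rev_blocks D 0 [] \<sigma>"])
  also have "?F = map_pmf fst (pair_pmf ?F ?c)"
    by (simp add: map_fst_pair_pmf)
  finally have 1: "ungar_step (1 - s\<^sup>2) \<sigma> =
      map_pmf (\<lambda>(f, c). rev_blocks {i \<in> descents \<sigma>. f i} 0 [] \<sigma>) (pair_pmf ?F ?c)"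
    by (simp add: map_pmf_comp case_prod_unfold)
  have "map_pmf (\<lambda>(f, c). G (f (hd ?x) \<and> c) (map f (tl ?x))) (pair_pmf ?F ?c) =
      do {f \<leftarrow> ?F; c \<leftarrow> ?c; return_pmf (G (f (hd ?x) \<and> c) (map f (tl ?x)))}"
    by (simp add: pair_pmf_def map_bind_pmf)
  also have "\<dots> = do {bs \<leftarrow> map_pmf (\<lambda>f. map f ?x) ?F; c \<leftarrow> ?c; return_pmf (G (hd bs \<and> c) (tl bs))}"
    using len by (cases ?x) (simp_all add: bind_map_pmf)
  also have "map_pmf (\<lambda>f. map f ?x) ?F = replicate_pmf (Suc (length gs)) ?q"
    using length_perms[OF \<sigma>] unfolding len[symmetric]
    by (intro map_Pi_pmf_replicate) (auto simp: distinct_bigs set_bigs)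
  also have "do {bs \<leftarrow> replicate_pmf (Suc (length gs)) ?q; c \<leftarrow> ?c; return_pmf (G (hd bs \<and> c) (tl bs))} =
      do {b \<leftarrow> ?q; bs \<leftarrow> replicate_pmf (length gs) ?q; c \<leftarrow> ?c; return_pmf (G (b \<and> c) bs)}"
    by (simp add: bind_assoc_pmf bind_return_pmf)
  also have "\<dots> = do {b \<leftarrow> ?q; c \<leftarrow> ?c; bs \<leftarrow> replicate_pmf (length gs) ?q; return_pmf (G (b \<and> c) bs)}"
    by (subst (2) bind_commute_pmf) (rule refl)
  also have "\<dots> = do {d \<leftarrow> do {b \<leftarrow> ?q; c \<leftarrow> ?c; return_pmf (b \<and> c)};
      bs \<leftarrow> replicate_pmf (length gs) ?q; return_pmf (G d bs)}"
    by (simp add: bind_assoc_pmf bind_return_pmf)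
  also have "\<dots> = tasep_step s y"
    unfolding bernoulli_pmf_thin[OF s] by (simp add: tasep_step_def y G_def)
  finally have 2: "tasep_step s y =
      map_pmf (\<lambda>(f, c). G (f (hd ?x) \<and> c) (map f (tl ?x))) (pair_pmf ?F ?c)" ..
  show ?thesis
    unfolding 1 2 pmf.rel_map
    using coupled_step[OF R[unfolded y] k]
    by (intro rel_pmf_reflI) (auto simp: G_def)
qed

text \<open>With this \<open>l\<close> the TASEP particle \<open>i\<close> starts no further right
  than \<open>n - k - 1 - i\<close>, which by \<open>bigs_nth_lower\<close> is the leftmost possible
  position of the true particle.\<close>

lemma coupled_init:
  assumes "\<sigma> \<in> perms n" "length gs = n - k - 1"
  shows "coupled n k (- int (sum_list gs)) \<sigma> (gs, 0)"
proof -
  have "tasep_pos (- int (sum_list gs)) gs i \<le> int (bigs k \<sigma> ! i)" if "i < n - k" for i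
  proof -
    have "sum_list (drop i gs) \<le> sum_list gs"
      by (metis append_take_drop_id le_add2 sum_list_append)
    then show ?thesis
      using bigs_nth_lower[of i k \<sigma>] that assms length_bigs_perms[OF assms(1), of k]
      by (simp add: tasep_pos_def)
  qed
  then show ?thesis
    using assms by (auto simp: coupled_def intro: min.coboundedI1)
qed

lemma rel_ungar_tasep_dist:
  assumes s: "0 < s" "s < 1" and \<sigma>: "\<sigma> \<in> perms n" and k: "k < n" and gs: "length gs = n - k - 1"
  shows "rel_pmf (coupled n k (- int (sum_list gs))) (ungar_dist (1 - s\<^sup>2) \<sigma> t) (tasep_dist s gs t)"
proof (induction t)
  case 0
  then show ?case
    using coupled_init[OF \<sigma> gs] by (simp add: ungar_dist_def tasep_dist_def)
next
  case (Suc t)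
  then show ?case
    using rel_ungar_tasep_step[OF s _ k]
    by (auto simp: ungar_dist_def tasep_dist_def intro!: rel_pmf_bindI)
qed

text \<open>For the last particle the cap \<open>n - 1 - i\<close> equals \<open>k\<close>, so the
  TASEP position itself must be below \<open>k\<close>.\<close>

lemma coupled_last:
  assumes "coupled n k (- int (sum_list gs0)) \<sigma> (gs, N)" "k < n" "bigs k \<sigma> ! (n - k - 1) < k"
  shows "N < k + sum_list gs0"
proof -
  have dom: "\<forall>i<n - k. min (tasep_pos (- int (sum_list gs0) + int N) gs i) (int n - 1 - int i)
      \<le> int (bigs k \<sigma> ! i)" and gs: "length gs = n - k - 1"
    using assms(1) by (auto simp: coupled_def)
  have "min (tasep_pos (- int (sum_list gs0) + int N) gs (n - k - 1)) (int n - 1 - int (n - k - 1))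
      \<le> int (bigs k \<sigma> ! (n - k - 1))"
    using dom[rule_format, of "n - k - 1"] assms(2) by simp
  then show ?thesis
    using assms(2,3) gs by (simp add: tasep_pos_def)
qed

text \<open>The left side does not involve the gaps, so it may be averaged over stationary ones,
  making the displacement \<open>N\<close> binomial. As \<open>N < k + sum_list gs\<close> on the
  event, any level \<open>L\<close> is either at most the right side or at least
  \<open>N\<close>.\<close>

lemma prob_threshold_unsorted_le:
  assumes s: "0 < s" "s < 1" and \<sigma>: "\<sigma> \<in> perms n" and k: "k < n"
  shows "emeasure (ungar_dist (1 - s\<^sup>2) \<sigma> t) {\<tau>. bigs k \<tau> ! (n - k - 1) < k} \<le>
    emeasure (replicate_pmf (n - k - 1) (gap_pmf s)) {gs. L \<le> real k + real (sum_list gs)}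
    + emeasure (binomial_pmf t (1 - s)) {N. real N \<le> L}"
proof -
  let ?G = "replicate_pmf (n - k - 1) (gap_pmf s)"
  let ?U = "{\<tau>. bigs k \<tau> ! (n - k - 1) < k}"
  let ?A = "{gs. L \<le> real k + real (sum_list gs)}" and ?B = "{N. real N \<le> L}"
  have "emeasure (ungar_dist (1 - s\<^sup>2) \<sigma> t) ?U \<le> indicator ?A gs + emeasure (tasep_dist s gs t) (UNIV \<times> ?B)"
    if "gs \<in> set_pmf ?G" for gs
  proof -
    have gs: "length gs = n - k - 1"
      using that by (simp add: set_replicate_pmf)
    show ?thesis
    proof (cases "gs \<in> ?A")
      case True
      then show ?thesis
        by (auto intro: add_increasing2 order.trans[OF measure_pmf.emeasure_le_1])
    next
      case False
      have "measure (ungar_dist (1 - s\<^sup>2) \<sigma> t) ?U \<le>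
          measure (tasep_dist s gs t) {y. \<exists>\<tau>\<in>?U. coupled n k (- int (sum_list gs)) \<tau> y}"
        by (rule rel_pmf_measureD[OF rel_ungar_tasep_dist[OF s \<sigma> k gs]])
      also have "\<dots> \<le> measure (tasep_dist s gs t) (UNIV \<times> ?B)"
      proof (rule measure_pmf.finite_measure_mono)
        show "{y. \<exists>\<tau>\<in>?U. coupled n k (- int (sum_list gs)) \<tau> y} \<subseteq> UNIV \<times> ?B"
          using False by (auto dest!: coupled_last[OF _ k])
      qed simp
      finally show ?thesis
        using False by (simp add: measure_pmf.emeasure_eq_measure ennreal_leI indicator_def)
    qed
  qed
  then have "(\<integral>\<^sup>+gs. emeasure (ungar_dist (1 - s\<^sup>2) \<sigma> t) ?U \<partial>?G) \<le>
      (\<integral>\<^sup>+gs. indicator ?A gs + emeasure (tasep_dist s gs t) (UNIV \<times> ?B) \<partial>?G)"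
    by (intro nn_integral_mono_AE) (simp add: AE_measure_pmf_iff)
  also have "\<dots> = emeasure ?G ?A + emeasure (bind_pmf ?G (\<lambda>gs. tasep_dist s gs t)) (UNIV \<times> ?B)"
    by (subst nn_integral_add) auto
  also have "emeasure (bind_pmf ?G (\<lambda>gs. tasep_dist s gs t)) (UNIV \<times> ?B) =
      emeasure (map_pmf snd (pair_pmf ?G (binomial_pmf t (1 - s)))) ?B"
    unfolding tasep_dist_stationary[OF s] emeasure_map_pmf by (rule arg_cong) auto
  finally show ?thesis
    by (simp add: map_snd_pair_pmf measure_pmf.emeasure_space_1)
qed

section \<open>Large deviations\<close>

lemma emeasure_pmf_exp_markov:
  fixes M :: "'a pmf"
  shows "emeasure M {x. a \<le> X x} \<le> ennreal (exp (- a)) * (\<integral>\<^sup>+x. ennreal (exp (X x)) \<partial>M)"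
proof -
  have "emeasure M {x. a \<le> X x} = (\<integral>\<^sup>+x. indicator {x. a \<le> X x} x \<partial>M)"
    by simp
  also have "\<dots> \<le> (\<integral>\<^sup>+x. ennreal (exp (- a)) * ennreal (exp (X x)) \<partial>M)"
    by (intro nn_integral_mono)
      (auto simp: indicator_def ennreal_mult[symmetric] exp_add[symmetric] simp flip: ennreal_1 intro!: ennreal_leI)
  finally show ?thesis
    by (simp add: nn_integral_cmult)
qed

text \<open>The bound on \<theta> is the convergence condition for the geometric series of ratio
  \<open>s * exp \<theta> / (1 + s)\<close>.\<close>

lemma nn_integral_exp_gap:
  assumes s: "0 < s" and \<theta>: "s * exp \<theta> < 1 + s"
  shows "(\<integral>\<^sup>+g. ennreal (exp (\<theta> * real g)) \<partial>gap_pmf s) =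
    ennreal (s / (1 + s) + exp \<theta> / ((1 + s) * (1 + s - s * exp \<theta>)))"
proof -
  let ?b = "1 / (1 + s)" and ?z = "s * exp \<theta> / (1 + s)"
  have b: "0 < ?b" "?b \<le> 1" "1 - ?b = s / (1 + s)"
    using s by (auto simp: field_simps)
  have z: "0 \<le> ?z" "?z < 1"
    using s \<theta> by auto
  have "(\<integral>\<^sup>+g. ennreal (exp (\<theta> * real (Suc g))) \<partial>geometric_pmf ?b) =
      (\<Sum>g. ennreal (pmf (geometric_pmf ?b) g) * ennreal (exp (\<theta> * real (Suc g))))"
    by (simp add: nn_integral_measure_pmf nn_integral_count_space_nat)
  also have "\<dots> = (\<Sum>g. ennreal (exp \<theta> / (1 + s) * ?z ^ g))"
  proof (rule suminf_cong)
    fix g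
    have "pmf (geometric_pmf ?b) g * exp (\<theta> * real (Suc g)) = exp \<theta> / (1 + s) * ?z ^ g"
    proof -
      have "pmf (geometric_pmf ?b) g = (s / (1 + s)) ^ g * ?b"
        unfolding b(3)[symmetric] using b(1,2) by (intro pmf_geometric)
      moreover have "exp (\<theta> * real (Suc g)) = exp \<theta> * exp \<theta> ^ g"
        by (simp add: distrib_left exp_add exp_of_nat2_mult)
      ultimately show ?thesis
        by (simp add: power_mult_distrib power_divide mult_ac)
    qed
    then show "ennreal (pmf (geometric_pmf ?b) g) * ennreal (exp (\<theta> * real (Suc g))) =
        ennreal (exp \<theta> / (1 + s) * ?z ^ g)"
      by (simp only: ennreal_mult[symmetric] pmf_nonneg exp_ge_zero)
  qed
  also have "\<dots> = ennreal (exp \<theta> / (1 + s) * (1 / (1 - ?z)))"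
    using z s by (intro suminf_ennreal_eq sums_mult geometric_sums) auto
  also have "exp \<theta> / (1 + s) * (1 / (1 - ?z)) = exp \<theta> / (1 + s - s * exp \<theta>)"
    using s \<theta> by (simp add: divide_simps)
  finally have geo: "(\<integral>\<^sup>+g. ennreal (exp (\<theta> * real (Suc g))) \<partial>geometric_pmf ?b) =
      ennreal (exp \<theta> / (1 + s - s * exp \<theta>))" .
  have "(\<integral>\<^sup>+g. ennreal (exp (\<theta> * real g)) \<partial>gap_pmf s) =
      ennreal (exp \<theta> / (1 + s - s * exp \<theta>)) * ennreal ?b + ennreal (1 - ?b)"
    unfolding gap_pmf_def nn_integral_bind_pmf using b geo
    by (subst nn_integral_bernoulli_pmf) auto
  also have "\<dots> = ennreal (exp \<theta> / (1 + s - s * exp \<theta>) * ?b + (1 - ?b))"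
    using b \<theta> by (subst ennreal_mult[symmetric]) (auto intro!: ennreal_plus[symmetric])
  also have "exp \<theta> / (1 + s - s * exp \<theta>) * ?b + (1 - ?b) =
      s / (1 + s) + exp \<theta> / ((1 + s) * (1 + s - s * exp \<theta>))"
    unfolding b(3) by (simp add: mult.commute)
  finally show ?thesis .
qed

lemma nn_integral_exp_sum_list_replicate:
  "(\<integral>\<^sup>+gs. ennreal (exp (\<theta> * real (sum_list gs))) \<partial>replicate_pmf m q) =
    (\<integral>\<^sup>+g. ennreal (exp (\<theta> * real g)) \<partial>q) ^ m"
proof (induction m)
  case (Suc m)
  show ?case
    by (simp add: nn_integral_bind_pmf distrib_left exp_add ennreal_mult nn_integral_cmult
        nn_integral_multc Suc.IH)
qed simp

lemma nn_integral_exp_binomial: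
  assumes "0 \<le> q" "q \<le> 1"
  shows "(\<integral>\<^sup>+N. ennreal (exp (\<theta> * real N)) \<partial>binomial_pmf t q) = ennreal ((q * exp \<theta> + (1 - q)) ^ t)"
proof (induction t)
  case 0
  then show ?case using assms by (simp add: binomial_pmf_0)
next
  case (Suc t)
  let ?I = "ennreal ((q * exp \<theta> + (1 - q)) ^ t)"
  have "(\<integral>\<^sup>+N. ennreal (exp (\<theta> * real N)) \<partial>binomial_pmf (Suc t) q) =
      ennreal (exp \<theta>) * ?I * ennreal q + ?I * ennreal (1 - q)"
    using assms Suc.IH
    by (simp add: binomial_pmf_Suc distrib_left exp_add ennreal_mult nn_integral_cmult)
  also have "\<dots> = ennreal (exp \<theta> * (q * exp \<theta> + (1 - q)) ^ t * q + (q * exp \<theta> + (1 - q)) ^ t * (1 - q))"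
    using assms by (simp add: ennreal_mult[symmetric] ennreal_plus[symmetric] del: ennreal_plus)
  also have "exp \<theta> * (q * exp \<theta> + (1 - q)) ^ t * q + (q * exp \<theta> + (1 - q)) ^ t * (1 - q) =
      (q * exp \<theta> + (1 - q)) ^ Suc t"
    by (simp add: algebra_simps)
  finally show ?case .
qed

text \<open>At \<theta> = 0 both inequalities are equalities. The differences of their sides have
  derivatives \<open>B - 1\<close> and \<open>(1 - s) - a\<close> there, both positive.\<close>

lemma chernoff_parameter:
  fixes s a B :: real
  assumes s: "0 < s" "s < 1" and a: "a < 1 - s" and B: "1 < B"
  obtains \<theta> where "0 < \<theta>" "s * exp \<theta> < 1 + s"
    "s / (1 + s) + exp \<theta> / ((1 + s) * (1 + s - s * exp \<theta>)) \<le> exp (B * \<theta>)"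
    "(1 - s) * exp (- \<theta>) + (1 - (1 - s)) \<le> exp (- a * \<theta>)"
proof -
  have "((\<lambda>\<theta>. exp (B * \<theta>) - (s / (1 + s) + exp \<theta> / ((1 + s) * (1 + s - s * exp \<theta>))))
      has_real_derivative B - 1) (at 0)"
    using s by (auto intro!: derivative_eq_intros) (auto simp: algebra_simps)
  from DERIV_pos_inc_right[OF this] B obtain d1 where d1: "0 < d1"
    "\<And>h. 0 < h \<Longrightarrow> h < d1 \<Longrightarrow> s / (1 + s) + exp h / ((1 + s) * (1 + s - s * exp h)) < exp (B * h)"
    using s by (auto simp: divide_simps)
  have "((\<lambda>\<theta>. exp (- a * \<theta>) - ((1 - s) * exp (- \<theta>) + (1 - (1 - s))))
      has_real_derivative (1 - s) - a) (at 0)"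
    by (auto intro!: derivative_eq_intros)
  from DERIV_pos_inc_right[OF this] a obtain d2 where d2: "0 < d2"
    "\<And>h. 0 < h \<Longrightarrow> h < d2 \<Longrightarrow> (1 - s) * exp (- h) + (1 - (1 - s)) < exp (- a * h)"
    by auto
  \<comment> \<open>At \<theta> = \<open>d3\<close> the product \<open>s * exp \<theta>\<close>
    reaches \<open>1 + s\<close>.\<close>
  define d3 where "d3 = ln ((1 + s) / s)"
  have d3: "0 < d3"
    unfolding d3_def using s by (intro ln_gt_zero) simp
  define \<theta> where "\<theta> = min d1 (min d2 d3) / 2"
  have \<theta>: "0 < \<theta>" "\<theta> < d1" "\<theta> < d2" "\<theta> < d3"
    using d1 d2 d3 by (auto simp: \<theta>_def)
  have "exp \<theta> < (1 + s) / s"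
    using \<theta>(4) s unfolding d3_def by (metis exp_less_mono exp_ln divide_pos_pos add_pos_pos zero_less_one)
  then have "s * exp \<theta> < 1 + s"
    using s by (simp add: field_simps)
  then show ?thesis
    using d1(2)[of \<theta>] d2(2)[of \<theta>] \<theta> by (intro that[of \<theta>]) auto
qed

section \<open>Summation over thresholds and times\<close>

lemma set_pmf_ungar_dist: "\<sigma> \<in> perms n \<Longrightarrow> set_pmf (ungar_dist p \<sigma> t) \<subseteq> perms n"
  by (induction t) (auto simp: ungar_dist_def ungar_step_def intro: rev_blocks_perms)

text \<open>A union bound over the thresholds, with a Chernoff bound for each of the two terms of
  \<open>prob_threshold_unsorted_le\<close>.\<close>

lemma prob_not_identity_le:
  assumes s: "0 < s" "s < 1" and \<theta>: "0 < \<theta>" "s * exp \<theta> < 1 + s"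
    and M: "s / (1 + s) + exp \<theta> / ((1 + s) * (1 + s - s * exp \<theta>)) \<le> exp (B * \<theta>)" and B: "1 < B"
    and W: "(1 - s) * exp (- \<theta>) + (1 - (1 - s)) \<le> exp (- a * \<theta>)"
    and \<sigma>: "\<sigma> \<in> perms n"
  shows "emeasure (ungar_dist (1 - s\<^sup>2) \<sigma> t) {\<tau>. \<tau> \<noteq> [0..<n]} \<le>
    ennreal (2 * real n * exp (- (\<theta> / 2) * (a * real t - B * real n)))"
proof -
  \<comment> \<open>The midpoint of \<open>B * n\<close> and \<open>a * t\<close> gives both
    Chernoff bounds the same value \<open>e\<close>.\<close>
  define L where "L = (B * real n + a * real t) / 2"
  define e where "e = exp (- (\<theta> / 2) * (a * real t - B * real n))"
  let ?U = "\<lambda>k. {\<tau>. bigs k \<tau> ! (n - k - 1) < k}"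
  have U: "emeasure (ungar_dist (1 - s\<^sup>2) \<sigma> t) (?U k) \<le> ennreal (2 * e)" if k: "k \<in> {0<..<n}" for k
  proof -
    have "emeasure (replicate_pmf (n - k - 1) (gap_pmf s)) {gs. L \<le> real k + real (sum_list gs)} =
        emeasure (replicate_pmf (n - k - 1) (gap_pmf s)) {gs. \<theta> * (L - real k) \<le> \<theta> * real (sum_list gs)}"
      using \<theta> by (intro arg_cong2[of _ _ _ _ emeasure]) auto
    also have "\<dots> \<le> ennreal (exp (- (\<theta> * (L - real k)))) *
        ennreal (s / (1 + s) + exp \<theta> / ((1 + s) * (1 + s - s * exp \<theta>))) ^ (n - k - 1)"
      using emeasure_pmf_exp_markov[of "replicate_pmf (n - k - 1) (gap_pmf s)" "\<theta> * (L - real k)"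
          "\<lambda>gs. \<theta> * real (sum_list gs)"]
      unfolding nn_integral_exp_sum_list_replicate nn_integral_exp_gap[OF s(1) \<theta>(2)] .
    also have "\<dots> \<le> ennreal (exp (- (\<theta> * (L - real k)))) * ennreal (exp (B * \<theta>)) ^ (n - k - 1)"
      by (intro mult_left_mono power_mono ennreal_leI M) auto
    also have "\<dots> = ennreal (exp (- (\<theta> * (L - real k)) + real (n - k - 1) * (B * \<theta>)))"
      unfolding exp_add exp_of_nat_mult by (simp add: ennreal_power ennreal_mult)
    also have "\<dots> \<le> ennreal e"
    proof -
      \<comment> \<open>As \<open>B > 1\<close>, the offset \<open>k\<close> costs no more than
        \<open>k\<close> further gaps, so one bound serves all thresholds.\<close>
      have "real (n - k - 1) * B + real k \<le> B * real (n - k - 1) + B * real k"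
        using B mult_right_mono[of 1 B "real k"] by (simp add: mult.commute)
      also have "\<dots> \<le> B * real n"
        using B k by (auto simp: distrib_left[symmetric])
      finally have "\<theta> * (real (n - k - 1) * B + real k) \<le> \<theta> * (B * real n)"
        using \<theta> by (intro mult_left_mono) auto
      then show ?thesis
        unfolding e_def L_def by (intro ennreal_leI) (simp add: algebra_simps add_divide_distrib)
    qed
    finally have 1: "emeasure (replicate_pmf (n - k - 1) (gap_pmf s))
        {gs. L \<le> real k + real (sum_list gs)} \<le> ennreal e" .
    have "emeasure (binomial_pmf t (1 - s)) {N. real N \<le> L} =
        emeasure (binomial_pmf t (1 - s)) {N. - \<theta> * L \<le> - \<theta> * real N}"
      using \<theta> by (intro arg_cong2[of _ _ _ _ emeasure]) auto
    also have "\<dots> \<le> ennreal (exp (\<theta> * L)) * ennreal (((1 - s) * exp (- \<theta>) + (1 - (1 - s))) ^ t)"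
      using emeasure_pmf_exp_markov[of "binomial_pmf t (1 - s)" "- \<theta> * L" "\<lambda>N. - \<theta> * real N"] s
      by (subst (asm) nn_integral_exp_binomial) auto
    also have "\<dots> \<le> ennreal (exp (\<theta> * L)) * ennreal (exp (- a * \<theta>) ^ t)"
      using s W by (intro mult_left_mono ennreal_leI power_mono) auto
    also have "\<dots> = ennreal e"
      by (simp add: ennreal_mult[symmetric] exp_of_nat_mult[symmetric] exp_add[symmetric] e_def L_def)
        (simp add: field_simps)
    finally have 2: "emeasure (binomial_pmf t (1 - s)) {N. real N \<le> L} \<le> ennreal e" .
    have "emeasure (ungar_dist (1 - s\<^sup>2) \<sigma> t) (?U k) \<le> ennreal e + ennreal e"
      using prob_threshold_unsorted_le[OF s \<sigma>, of k t L] k 1 2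
      by (auto intro: order.trans add_mono)
    also have "\<dots> = ennreal (2 * e)"
      by (simp add: e_def ennreal_plus[symmetric] del: ennreal_plus)
    finally show ?thesis .
  qed
  have "emeasure (ungar_dist (1 - s\<^sup>2) \<sigma> t) {\<tau>. \<tau> \<noteq> [0..<n]} \<le>
      emeasure (ungar_dist (1 - s\<^sup>2) \<sigma> t) (\<Union>k\<in>{0<..<n}. ?U k)"
    using set_pmf_ungar_dist[OF \<sigma>, of "1 - s\<^sup>2" t] perms_not_id_bigs[of _ n]
    by (intro emeasure_mono_AE) (auto simp: AE_measure_pmf_iff)
  also have "\<dots> \<le> (\<Sum>k\<in>{0<..<n}. emeasure (ungar_dist (1 - s\<^sup>2) \<sigma> t) (?U k))"
    by (intro emeasure_subadditive_finite) auto
  also have "\<dots> \<le> (\<Sum>k\<in>{0<..<n}. ennreal (2 * e))"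
    by (intro sum_mono U)
  also have "\<dots> = ennreal (real (n - 1) * (2 * e))"
    by (simp add: ennreal_mult ennreal_of_nat_eq_real_of_nat e_def)
  also have "\<dots> \<le> ennreal (2 * real n * e)"
    by (intro ennreal_leI) (auto simp: e_def)
  finally show ?thesis unfolding e_def .
qed

text \<open>Probabilities before time \<open>t0\<close> are bounded by 1, and those from
  \<open>t0\<close> on by a geometric series.\<close>

lemma ungar_E_le:
  assumes s: "0 < s" "s < 1" and \<theta>: "0 < \<theta>" "s * exp \<theta> < 1 + s"
    and M: "s / (1 + s) + exp \<theta> / ((1 + s) * (1 + s - s * exp \<theta>)) \<le> exp (B * \<theta>)" and B: "1 < B"
    and W: "(1 - s) * exp (- \<theta>) + (1 - (1 - s)) \<le> exp (- a * \<theta>)"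
    and a: "0 < a" and \<delta>: "0 \<le> \<delta>" and \<sigma>: "\<sigma> \<in> perms n"
  shows "ungar_E (1 - s\<^sup>2) \<sigma> \<le> ennreal ((B + \<delta>) / a * real n + 1 +
    2 * real n * exp (- (\<theta> / 2) * (\<delta> * real n)) / (1 - exp (- (\<theta> / 2) * a)))"
proof -
  define \<rho> where "\<rho> = exp (- (\<theta> / 2) * a)"
  have \<rho>: "0 < \<rho>" "\<rho> < 1"
    using \<theta> a by (auto simp: \<rho>_def)
  define C where "C = 2 * real n * exp (- (\<theta> / 2) * (\<delta> * real n))"
  \<comment> \<open>From this time on \<open>a * t\<close> exceeds \<open>B * n\<close> by at least
    \<open>\<delta> * n\<close>.\<close>
  define t0 where "t0 = nat \<lceil>(B + \<delta>) / a * real n\<rceil>"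
  have t0: "(B + \<delta>) / a * real n \<le> real t0" "real t0 \<le> (B + \<delta>) / a * real n + 1"
  proof -
    have "0 \<le> (B + \<delta>) / a * real n"
      using a B \<delta> by simp
    then show "(B + \<delta>) / a * real n \<le> real t0" "real t0 \<le> (B + \<delta>) / a * real n + 1"
      unfolding t0_def by linarith+
  qed
  let ?f = "\<lambda>t. emeasure (ungar_dist (1 - s\<^sup>2) \<sigma> t) {\<tau>. \<tau> \<noteq> [0..<n]}"
  have tail: "?f (t + t0) \<le> ennreal (C * \<rho> ^ t)" for t
  proof -
    have "(B + \<delta>) * real n \<le> a * real t0"
      using t0(1) a by (simp add: field_simps)
    then have "\<theta> / 2 * (\<delta> * real n + a * real t) \<le> \<theta> / 2 * (a * real (t + t0) - B * real n)"
      using \<theta> by (intro mult_left_mono) (auto simp: algebra_simps)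
    then have "exp (- (\<theta> / 2) * (a * real (t + t0) - B * real n)) \<le>
        exp (- (\<theta> / 2) * (\<delta> * real n) + real t * (- (\<theta> / 2) * a))"
      by (simp add: algebra_simps)
    also have "\<dots> = exp (- (\<theta> / 2) * (\<delta> * real n)) * \<rho> ^ t"
      unfolding exp_add exp_of_nat_mult \<rho>_def ..
    finally have "2 * real n * exp (- (\<theta> / 2) * (a * real (t + t0) - B * real n)) \<le> C * \<rho> ^ t"
      unfolding C_def mult.assoc by (intro mult_left_mono) auto
    then show ?thesis
      using prob_not_identity_le[OF s \<theta> M B W \<sigma>, of "t + t0"] ennreal_leI order.trans by blast
  qed
  have "ungar_E (1 - s\<^sup>2) \<sigma> = (\<Sum>t. ?f t)"
    by (simp add: ungar_E_def length_perms[OF \<sigma>] measure_pmf.emeasure_eq_measure)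
  also have "\<dots> = (\<Sum>t. ?f (t + t0)) + (\<Sum>t<t0. ?f t)"
    by (rule suminf_offset) simp
  also have "\<dots> \<le> (\<Sum>t. ennreal (C * \<rho> ^ t)) + (\<Sum>t<t0. 1)"
    by (intro add_mono suminf_le sum_mono tail measure_pmf.emeasure_le_1) auto
  also have "(\<Sum>t. ennreal (C * \<rho> ^ t)) = ennreal (C * (1 / (1 - \<rho>)))"
    using \<rho> by (intro suminf_ennreal_eq sums_mult geometric_sums) (auto simp: C_def)
  also have "\<dots> + (\<Sum>t<t0. 1) = ennreal (C * (1 / (1 - \<rho>)) + real t0)"
    using \<rho> by (simp add: ennreal_of_nat_eq_real_of_nat C_def)
  also have "\<dots> \<le> ennreal ((B + \<delta>) / a * real n + 1 + C / (1 - \<rho>))"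
    using t0(2) by (intro ennreal_leI) simp
  finally show ?thesis
    unfolding C_def \<rho>_def .
qed

text \<open>With \<open>a\<close> close to \<open>1 - s\<close> and \<open>B\<close>, \<delta> close
  to 1 and 0, the linear coefficient stays below \<open>c\<close>; the other terms of
  \<open>ungar_E_le\<close> vanish after division by \<open>n\<close>.\<close>

lemma eventually_ungar_E_le:
  assumes s: "0 < s" "s < 1" and c: "1 / (1 - s) < c"
  shows "\<forall>\<^sub>F n in at_top. \<forall>\<sigma>\<in>perms n. ungar_E (1 - s\<^sup>2) \<sigma> \<le> ennreal (c * real n)"
proof -
  have "0 < c"
    using s c by (meson diff_gt_0_iff_gt less_trans zero_less_divide_1_iff)
  then have "1 / c < 1 - s"
    using s c by (simp add: field_simps)
  then obtain a where a: "1 / c < a" "a < 1 - s"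
    using dense by blast
  then have a0: "0 < a"
    using \<open>0 < c\<close> by (meson less_trans zero_less_divide_1_iff)
  \<comment> \<open>The quarter makes \<open>B + \<delta> = (1 + a * c) / 2\<close>, which is below
    \<open>a * c\<close> because \<open>a * c > 1\<close>.\<close>
  define \<delta> where "\<delta> = (a * c - 1) / 4"
  define B where "B = 1 + \<delta>"
  have \<delta>: "0 < \<delta>"
    using a(1) \<open>0 < c\<close> by (simp add: \<delta>_def field_simps)
  have Bc: "(B + \<delta>) / a < c"
    using \<delta> a0 by (simp add: B_def \<delta>_def field_simps)
  have B: "1 < B"
    using \<delta> by (simp add: B_def)
  obtain \<theta> where \<theta>: "0 < \<theta>" "s * exp \<theta> < 1 + s"
    "s / (1 + s) + exp \<theta> / ((1 + s) * (1 + s - s * exp \<theta>)) \<le> exp (B * \<theta>)"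
    "(1 - s) * exp (- \<theta>) + (1 - (1 - s)) \<le> exp (- a * \<theta>)"
    using chernoff_parameter[OF s a(2) B] .
  define \<kappa> where "\<kappa> = \<theta> / 2 * \<delta>"
  define K where "K = 1 - exp (- (\<theta> / 2) * a)"
  have \<kappa>: "0 < \<kappa>" using \<theta> \<delta> by (simp add: \<kappa>_def)
  have "(\<lambda>n. (B + \<delta>) / a + 1 / real n + 2 * exp (- \<kappa> * real n) / K) \<longlonglongrightarrow> (B + \<delta>) / a + 0 + 2 * 0 / K"
  proof (intro tendsto_add lim_1_over_n tendsto_divide tendsto_mult tendsto_const)
    show "(\<lambda>n. exp (- \<kappa> * real n)) \<longlonglongrightarrow> 0"
      using \<kappa> by real_asymp
    show "K \<noteq> 0"
      using \<theta>(1) a0 by (simp add: K_def)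
  qed (use a0 in simp)
  then have "\<forall>\<^sub>F n in sequentially. (B + \<delta>) / a + 1 / real n + 2 * exp (- \<kappa> * real n) / K < c"
    by (rule order_tendstoD(2)) (use Bc in simp)
  then show ?thesis
    using eventually_gt_at_top[of 0]
  proof eventually_elim
    case (elim n)
    then have "((B + \<delta>) / a + 1 / real n + 2 * exp (- \<kappa> * real n) / K) * real n \<le> c * real n"
      by (intro mult_right_mono) auto
    moreover have "((B + \<delta>) / a + 1 / real n + 2 * exp (- \<kappa> * real n) / K) * real n =
        (B + \<delta>) / a * real n + 1 + 2 * real n * exp (- (\<theta> / 2) * (\<delta> * real n)) / K"
      using elim by (simp add: distrib_right \<kappa>_def)
    ultimately show ?case
      using ungar_E_le[OF s \<theta>(1-3) B \<theta>(4) a0, of \<delta> _ n] \<delta>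
      unfolding K_def[symmetric] by (auto intro: order.trans ennreal_leI)
  qed
qed

theorem theorem3p1:
  fixes p :: real
  assumes "0 < p" and "p < 1"
  shows "\<exists>f :: nat \<Rightarrow> real. f \<in> o(\<lambda>n. real n) \<and>
    (\<forall>\<^sub>F n in at_top.
       (MAX \<sigma>\<in>perms n. ungar_E p \<sigma>) \<le> ennreal ((1 + sqrt (1 - p)) / p * real n + f n))"
proof -
  define s where "s = sqrt (1 - p)"
  have s: "0 < s" "s < 1" and p: "p = 1 - s\<^sup>2"
    using assms by (auto simp: s_def)
  \<comment> \<open>This factorization turns the stated constant into \<open>1 / (1 - s)\<close>,
    the inverse speed of the last particle.\<close>
  have "p = (1 + s) * (1 - s)"
    by (simp add: p power2_eq_square algebra_simps)
  then have c: "(1 + s) / p = 1 / (1 - s)"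
    using s by simp
  define m where "m n = (MAX \<sigma>\<in>perms n. ungar_E p \<sigma>)" for n
  \<comment> \<open>The positive part of the excess over the linear term; \<open>m\<close> below
    bounds it by \<open>e * n\<close> eventually, for every positive \<open>e\<close>.\<close>
  define f where "f n = max 0 (enn2real (m n) - (1 + s) / p * real n)" for n
  have m: "\<forall>\<^sub>F n in at_top. m n \<le> ennreal (c' * real n)" if "(1 + s) / p < c'" for c'
    using eventually_ungar_E_le[OF s that[unfolded c]] unfolding p[symmetric]
  proof eventually_elim
    case (elim n)
    have "finite (perms n)" "perms n \<noteq> {}"
      by (auto simp: perms_def)
    with elim show ?case
      by (auto simp: m_def)
  qed
  have "f \<in> o(\<lambda>n. real n)"
  proof (rule landau_o.smallI)
    fix e :: real
    assume e: "0 < e"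
    have "\<forall>\<^sub>F n in at_top. m n \<le> ennreal (((1 + s) / p + e) * real n)"
      using e by (intro m) simp
    then show "\<forall>\<^sub>F n in sequentially. norm (f n) \<le> e * norm (real n)"
    proof eventually_elim
      case (elim n)
      then have "enn2real (m n) \<le> ((1 + s) / p + e) * real n"
        using s assms e by (intro enn2real_leI) auto
      with e show ?case
        by (auto simp: f_def distrib_right)
    qed
  qed
  \<comment> \<open>Since \<open>enn2real\<close> sends infinity to 0, finiteness of
    \<open>m n\<close> is secured first; any constant above the critical one does.\<close>
  moreover have "\<forall>\<^sub>F n in at_top. m n \<le> ennreal ((1 + s) / p * real n + f n)"
    using m[of "(1 + s) / p + 1", simplified]
  proof eventually_elim
    case (elim n)
    then have "m n = ennreal (enn2real (m n))"
      by (metis ennreal_enn2real ennreal_less_top order.strict_trans1)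
    also have "\<dots> \<le> ennreal ((1 + s) / p * real n + f n)"
      by (intro ennreal_leI) (simp add: f_def)
    finally show ?case .
  qed
  ultimately show ?thesis
    unfolding m_def s_def by blast
qed

end
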